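(* Let $\mathcal{H}$ be a real Hilbert space, let $A, C\colon \mathcal{H}\rightrightarrows\mathcal{H}$ be maximally monotone operators, and let $B\colon\mathcal{H}\to\mathcal{H}$ be single-valued, monotone and $L$-Lipschitz continuous with $L>0$. Suppose $(A+B+C)^{-1}(0)\neq\emptyset$ and let $\lambda\in\left(0,\frac{1}{8L}\right)$. For arbitrary initial points $z_0, y_{-1}, y_{-2}\in\mathcal{H}$, consider the sequences $(z_k)_{k\in\mathbb{N}}$, $(x_k)_{k\in\mathbb{N}}$ and $(y_k)_{k\in\mathbb{N}}$ given, for $k=0,1,2,\dots$, by $$ \left\{\begin{aligned} x_k &= J_{\lambda A}(z_k),\\ y_k &= J_{\lambda C}\bigl(2x_k - z_k - 2\lambda B(y_{k-1}) + \lambda B(y_{k-2})\bigr),\\ z_{k+1} &= z_k + y_k - x_k. \end{aligned}\right. $$ Then the following assertions hold: (a) The sequence $(z_k)_{k\in\mathbb{N}}$ converges weakly to a point $\bar z\in\mathcal{H}$. (b) The sequences $(x_k)_{k\in\mathbb{N}}$ and $(y_k)_{k\in\mathbb{N}}$ converge weakly to a (common) point $\bar x\in\mathcal{H}$. (c) We have $\bar x = J_{\lambda A}(\bar z)\in (A+B+C)^{-1}(0)$.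
   Context: $\mathbb{N}=\{0,1,2,\dots\}$. For a maximally monotone operator $T\colon\mathcal{H}\rightrightarrows\mathcal{H}$, $J_T := (\mathrm{Id}+T)^{-1}$ denotes its resolvent, which is a single-valued operator defined on all of $\mathcal{H}$. The set $(A+B+C)^{-1}(0)$ is $\{x\in\mathcal{H} : 0\in A(x)+B(x)+C(x)\}$. The iteration in the claim is called the backward-forward-reflected-backward method. *)

theory Defs
  imports "HOL-Analysis.Analysis" "HOL-Library.Set_Algebras"
begin

text \<open>
  A set-valued operator on a real Hilbert space is a function into the powerset. Sums of
  values such as \<open>A x + {B x} + C x\<close> are Minkowski sums; a single-valued operator \<open>B\<close> is
  identified with \<open>\<lambda>x. {B x}\<close>. A real Hilbert space is a type of sort
  \<open>{real_inner, banach}\<close>.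
\<close>

definition op_graph :: "('a \<Rightarrow> 'b set) \<Rightarrow> ('a \<times> 'b) set" where
  "op_graph T = {(x, u). u \<in> T x}"

definition op_inverse :: "('a \<Rightarrow> 'b set) \<Rightarrow> 'b \<Rightarrow> 'a set" where
  "op_inverse T u = {x. u \<in> T x}"

definition op_scale :: "real \<Rightarrow> ('a \<Rightarrow> 'b::real_vector set) \<Rightarrow> 'a \<Rightarrow> 'b set" where
  "op_scale c T x = (\<lambda>u. c *\<^sub>R u) ` T x"

definition monotone_operator :: "('a::real_inner \<Rightarrow> 'a set) \<Rightarrow> bool" where
  "monotone_operator T \<longleftrightarrow>
    (\<forall>(x, u) \<in> op_graph T. \<forall>(y, v) \<in> op_graph T. inner (x - y) (u - v) \<ge> 0)"

definition maximally_monotone :: "('a::real_inner \<Rightarrow> 'a set) \<Rightarrow> bool" where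
  "maximally_monotone T \<longleftrightarrow>
    monotone_operator T \<and> (\<nexists>S. monotone_operator S \<and> op_graph T \<subset> op_graph S)"

text \<open>
  The resolvent is the inverse of \<open>Id + T\<close>, read as a function. The description operator is
  meaningful because for maximally monotone \<open>T\<close> on a Hilbert space this inverse has exactly
  one value at every point (Minty's theorem).
\<close>

definition resolvent :: "('a::real_inner \<Rightarrow> 'a set) \<Rightarrow> 'a \<Rightarrow> 'a" where
  "resolvent T z = (THE x. x \<in> op_inverse (\<lambda>x. {x} + T x) z)"

definition converges_weakly :: "(nat \<Rightarrow> 'a::real_inner) \<Rightarrow> 'a \<Rightarrow> bool" where
  "converges_weakly X l \<longleftrightarrow> (\<forall>u. (\<lambda>n. inner (X n) u) \<longlonglongrightarrow> inner l u)"

end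

theory Submission
  imports Defs
begin

text \<open>
  Replacing \<open>A\<close>, \<open>B\<close>, \<open>C\<close> by \<open>lam A\<close>, \<open>lam B\<close>, \<open>lam C\<close> reduces the claim to unit step size
  and a \<open>t\<close>-Lipschitz \<open>B\<close> with \<open>t = lam * L < 1 / 8\<close>. Adding the monotonicity inequalities at a
  zero \<open>p\<close> with \<open>a \<in> A p\<close>, the squared distance of \<open>z\<^sub>k\<close> to \<open>p + a\<close>, corrected by a cross term and by
  multiples of the last two squared residuals \<open>\<parallel>y\<^sub>k - x\<^sub>k\<parallel>\<^sup>2\<close>, decreases by at least
  \<open>(1 - 8 * t) * \<parallel>y\<^sub>k - x\<^sub>k\<parallel>\<^sup>2\<close>. The Lipschitz terms are absorbed because the increments of \<open>y\<close> are
  controlled by the residuals, \<open>Id - J\<^sub>A\<close> being nonexpansive. Hence the residuals vanish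
  and the distance of \<open>z\<^sub>k\<close> to every such \<open>p + a\<close> converges. Weak limit points of \<open>z\<close> are again
  of the form \<open>p + a\<close>, and Opial's argument shows that there is only one.
\<close>

subsection \<open>Proximal minimisation over a closed convex set\<close>

lemma norm_add_squared:
  fixes u v :: "'a::real_inner"
  shows "(norm (u + v))\<^sup>2 = (norm u)\<^sup>2 + 2 * inner u v + (norm v)\<^sup>2"
  by (simp add: power2_norm_eq_inner inner_add_left inner_add_right inner_commute)

text \<open>Completeness yields a minimiser of \<open>s + (norm q)\<^sup>2 / 2\<close> over
  \<open>E\<close>: strict convexity in \<open>q\<close> makes every minimising sequence Cauchy in
  its first component, and convergence of the values then settles the second. The inequality is the
  first-order condition along segments.\<close>

lemma prox_variational_inequality:
  fixes E :: "('a::{real_inner, banach} \<times> real) set"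
  assumes "closed E" "convex E" "E \<noteq> {}"
    and bound: "\<And>q s. (q, s) \<in> E \<Longrightarrow> b \<le> s + (norm q)\<^sup>2 / 2"
  obtains p r where "(p, r) \<in> E" "\<And>q s. (q, s) \<in> E \<Longrightarrow> r \<le> s + inner p (q - p)"
proof -
  define g where "g w = snd w + (norm (fst w))\<^sup>2 / 2" for w :: "'a \<times> real"
  define m where "m = Inf (g ` E)"
  have bdd: "bdd_below (g ` E)"
    using bound by (intro bdd_belowI[of _ b]) (auto simp: g_def)
  have m_le: "m \<le> g w" if "w \<in> E" for w
    unfolding m_def using that bdd by (simp add: cINF_lower)
  have "\<exists>w\<in>E. g w < m + 1 / real (Suc n)" for n
  proof -
    have "Inf (g ` E) < m + 1 / real (Suc n)" by (simp add: m_def)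
    then show ?thesis
      using cInf_less_iff[OF _ bdd] \<open>E \<noteq> {}\<close> by (auto simp del: of_nat_Suc)
  qed
  then obtain w where wE: "\<And>n. w n \<in> E" and w: "\<And>n. g (w n) < m + 1 / real (Suc n)"
    by metis
  have g_lim: "(\<lambda>n. g (w n)) \<longlonglongrightarrow> m"
  proof (rule tendsto_sandwich[OF _ _ tendsto_const])
    show "\<forall>\<^sub>F n in sequentially. m \<le> g (w n)"
      using m_le wE by simp
    show "\<forall>\<^sub>F n in sequentially. g (w n) \<le> m + 1 / real (Suc n)"
      using w by (simp add: less_imp_le del: of_nat_Suc)
    show "(\<lambda>n. m + 1 / real (Suc n)) \<longlonglongrightarrow> m"
      using tendsto_add[OF tendsto_const LIMSEQ_inverse_real_of_nat, of m]
      by (simp add: inverse_eq_divide)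
  qed
  \<comment> \<open>The midpoint lies in \<open>E\<close>, so its value is at least
    \<open>m\<close>; the parallelogram law turns this into a bound on the distance.\<close>
  have mid: "(norm (fst v - fst v'))\<^sup>2 \<le> 4 * (g v + g v' - 2 * m)" if "v \<in> E" "v' \<in> E" for v v'
  proof -
    have "(1/2) *\<^sub>R v + (1/2) *\<^sub>R v' \<in> E"
      using that \<open>convex E\<close> by (auto simp: convex_def)
    from m_le[OF this] have "m \<le> (snd v + snd v') / 2 + (norm ((1/2) *\<^sub>R (fst v + fst v')))\<^sup>2 / 2"
      by (simp add: g_def scaleR_add_right add_divide_distrib)
    moreover have "(norm ((1/2) *\<^sub>R (fst v + fst v')))\<^sup>2 = (norm (fst v + fst v'))\<^sup>2 / 4"
      by (simp add: power_divide)
    moreover have "(norm (fst v + fst v'))\<^sup>2 + (norm (fst v - fst v'))\<^sup>2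
        = 2 * (norm (fst v))\<^sup>2 + 2 * (norm (fst v'))\<^sup>2"
      by (simp add: power2_norm_eq_inner inner_add_left inner_add_right
          inner_diff_left inner_diff_right)
    ultimately show ?thesis
      by (simp add: g_def field_simps)
  qed
  have "Cauchy (\<lambda>n. fst (w n))"
  proof (rule metric_CauchyI)
    fix e :: real assume "e > 0"
    then have "eventually (\<lambda>n. g (w n) < m + e\<^sup>2 / 8) sequentially"
      using g_lim by (auto intro: order_tendstoD)
    then obtain N where N: "\<And>n. n \<ge> N \<Longrightarrow> g (w n) < m + e\<^sup>2 / 8"
      by (auto simp: eventually_sequentially)
    have "dist (fst (w i)) (fst (w j)) < e" if "i \<ge> N" "j \<ge> N" for i j
    proof -
      have "(norm (fst (w i) - fst (w j)))\<^sup>2 < e\<^sup>2"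
        using mid[OF wE[of i] wE[of j]] N[OF that(1)] N[OF that(2)] by argo
      then show ?thesis
        using \<open>e > 0\<close> by (simp add: dist_norm power2_less_imp_less)
    qed
    then show "\<exists>M. \<forall>i\<ge>M. \<forall>j\<ge>M. dist (fst (w i)) (fst (w j)) < e" by blast
  qed
  then obtain p where p: "(\<lambda>n. fst (w n)) \<longlonglongrightarrow> p"
    using Cauchy_convergent convergent_def by blast
  define r where "r = m - (norm p)\<^sup>2 / 2"
  have "(\<lambda>n. g (w n) - (norm (fst (w n)))\<^sup>2 / 2) \<longlonglongrightarrow> r"
    unfolding r_def by (intro tendsto_intros g_lim p) simp
  then have "(\<lambda>n. snd (w n)) \<longlonglongrightarrow> r" by (simp add: g_def)
  with p have "(\<lambda>n. (fst (w n), snd (w n))) \<longlonglongrightarrow> (p, r)" by (rule tendsto_Pair)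
  then have "w \<longlonglongrightarrow> (p, r)" by simp
  with \<open>closed E\<close> wE have prE: "(p, r) \<in> E"
    by (meson closed_sequentially)
  have "r \<le> s + inner p (q - p)" if qs: "(q, s) \<in> E" for q s
  proof -
    \<comment> \<open>Minimality is tested at a point of the segment towards \<open>(q, s)\<close>
      and divided by \<open>t\<close>; letting \<open>t\<close> tend to 0 afterwards removes the
      quadratic term.\<close>
    have "0 \<le> s - r + inner p (q - p) + t * ((norm (q - p))\<^sup>2 / 2)" if t: "0 < t" "t < 1" for t
    proof -
      have "(1 - t) *\<^sub>R (p, r) + t *\<^sub>R (q, s) \<in> E"
        using t qs prE \<open>convex E\<close> unfolding convex_alt by (meson less_imp_le)
      from m_le[OF this] have "r + (norm p)\<^sup>2 / 2 \<le> g ((1 - t) *\<^sub>R (p, r) + t *\<^sub>R (q, s))"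
        by (simp add: r_def)
      also have "\<dots> = r + (norm p)\<^sup>2 / 2 + t * (s - r + inner p (q - p) + t * ((norm (q - p))\<^sup>2 / 2))"
      proof -
        have "fst ((1 - t) *\<^sub>R (p, r) + t *\<^sub>R (q, s)) = p + t *\<^sub>R (q - p)"
          by (simp add: algebra_simps)
        moreover have "(norm (p + t *\<^sub>R (q - p)))\<^sup>2
            = (norm p)\<^sup>2 + 2 * t * inner p (q - p) + t * (t * (norm (q - p))\<^sup>2)"
          by (simp add: norm_add_squared power_mult_distrib power2_eq_square[of t])
        ultimately show ?thesis by (simp add: g_def algebra_simps)
      qed
      finally show ?thesis using t by (simp add: zero_le_mult_iff)
    qed
    then have "eventually (\<lambda>t. 0 \<le> s - r + inner p (q - p) + t * ((norm (q - p))\<^sup>2 / 2)) (at_right 0)"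
      by (auto simp: eventually_at_right_field intro!: exI[of _ 1])
    moreover have "((\<lambda>t. s - r + inner p (q - p) + t * ((norm (q - p))\<^sup>2 / 2)) \<longlongrightarrow>
        s - r + inner p (q - p) + 0 * ((norm (q - p))\<^sup>2 / 2)) (at_right 0)"
      by (intro tendsto_intros)
    ultimately have "0 \<le> s - r + inner p (q - p) + 0 * ((norm (q - p))\<^sup>2 / 2)"
      by (intro tendsto_lowerbound) auto
    then show ?thesis by simp
  qed
  with prE show thesis by (rule that)
qed

text \<open>The representing vector minimises \<open>(norm q)\<^sup>2 / 2 - f q\<close>, so
  \<open>E\<close> is the graph of \<open>- f\<close>. As \<open>E\<close> is a linear subspace, the
  variational inequality can be used in the directions \<open>u\<close> and
  \<open>- u\<close>.\<close>

lemma riesz_representation: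
  fixes f :: "'a::{real_inner, banach} \<Rightarrow> real"
  assumes "bounded_linear f"
  obtains p where "\<And>u. f u = inner p u"
proof -
  interpret bounded_linear f by fact
  obtain K where K: "\<And>u. norm (f u) \<le> norm u * K" using bounded by blast
  define E where "E = {w. snd w + f (fst w) = 0}"
  have "continuous_on UNIV (\<lambda>w::'a \<times> real. snd w + f (fst w))"
    by (intro continuous_intros continuous_on)
  then have "closed E"
    unfolding E_def by (intro closed_Collect_eq) auto
  moreover have "convex E"
    unfolding convex_def
  proof (intro ballI allI impI)
    fix v w :: "'a \<times> real" and a c :: real
    assume "v \<in> E" "w \<in> E"
    then have "snd v = - f (fst v)" "snd w = - f (fst w)" by (auto simp: E_def)
    then show "a *\<^sub>R v + c *\<^sub>R w \<in> E"
      by (simp add: E_def add scaleR)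
  qed
  moreover have "(0, 0) \<in> E" by (simp add: E_def zero)
  \<comment> \<open>Completing the square in \<open>norm q\<close> gives the lower bound.\<close>
  moreover have "- (K\<^sup>2) / 2 \<le> s + (norm q)\<^sup>2 / 2" if "(q, s) \<in> E" for q s
  proof -
    have "s \<ge> - (norm q * K)" using that K[of q] by (auto simp: E_def)
    moreover have "(norm q - K)\<^sup>2 \<ge> 0" by simp
    ultimately show ?thesis by (simp add: power2_diff)
  qed
  ultimately obtain p r where "(p, r) \<in> E"
    and var: "\<And>q s. (q, s) \<in> E \<Longrightarrow> r \<le> s + inner p (q - p)"
    using prox_variational_inequality[of E "- (K\<^sup>2) / 2"] by blast
  then have r: "r = - f p" by (simp add: E_def)
  have le: "f u \<le> inner p u" for u
    using var[of "p + u" "- f (p + u)"] r by (simp add: E_def add)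
  moreover have "inner p u \<le> f u" for u
    using le[of "- u"] scaleR[of "- 1" u] by simp
  ultimately have "f u = inner p u" for u by (rule order_antisym)
  then show thesis by (rule that)
qed

subsection \<open>Resolvents of maximally monotone operators\<close>

lemma monotone_operatorD:
  "monotone_operator T \<Longrightarrow> u \<in> T x \<Longrightarrow> v \<in> T y \<Longrightarrow> 0 \<le> inner (x - y) (u - v)"
  by (force simp: monotone_operator_def op_graph_def)

text \<open>A pair monotonically related to the whole graph can be adjoined to it without losing
  monotonicity, so maximality under graph inclusion is a pointwise condition.\<close>

lemma maximally_monotone_iff:
  "maximally_monotone T \<longleftrightarrow> monotone_operator T \<and>
    (\<forall>x u. (\<forall>y v. v \<in> T y \<longrightarrow> 0 \<le> inner (x - y) (u - v)) \<longrightarrow> u \<in> T x)"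
  (is "_ \<longleftrightarrow> _ \<and> ?max")
proof -
  have ?max if T: "maximally_monotone T"
  proof (intro allI impI, rule ccontr)
    fix x u assume rel: "\<forall>y v. v \<in> T y \<longrightarrow> 0 \<le> inner (x - y) (u - v)" and "u \<notin> T x"
    define S where "S = T(x := insert u (T x))"
    have "monotone_operator T" using T by (simp add: maximally_monotone_def)
    moreover have "0 \<le> inner (y - x) (v - u)" if "v \<in> T y" for y v
      using rel that by (metis inner_minus_left inner_minus_right minus_diff_eq minus_minus)
    ultimately have "monotone_operator S"
      using rel by (auto simp: S_def monotone_operator_def op_graph_def split: if_splits)
    moreover have "op_graph T \<subset> op_graph S"
      using \<open>u \<notin> T x\<close> by (auto simp: S_def op_graph_def split: if_splits)
    ultimately show False using T by (auto simp: maximally_monotone_def)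
  qed
  moreover have "maximally_monotone T" if "monotone_operator T" ?max
  proof -
    have "op_graph S \<subseteq> op_graph T" if "monotone_operator S" "op_graph T \<subset> op_graph S" for S
    proof (clarsimp simp: op_graph_def)
      fix x u assume "u \<in> S x"
      have "0 \<le> inner (x - y) (u - v)" if "v \<in> T y" for y v
      proof -
        have "v \<in> S y" using that \<open>op_graph T \<subset> op_graph S\<close> by (auto simp: op_graph_def)
        then show ?thesis using monotone_operatorD \<open>u \<in> S x\<close> \<open>monotone_operator S\<close> by blast
      qed
      then show "u \<in> T x" using \<open>?max\<close> by blast
    qed
    then show ?thesis using that by (auto simp: maximally_monotone_def)
  qed
  ultimately show ?thesis by (auto simp: maximally_monotone_def)
qed

text \<open>
  The set \<open>E\<close> is the epigraph of the Fitzpatrick function of \<open>T\<close>, which dominates the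
  duality pairing because \<open>T\<close> is maximal. Its proximal point \<open>(x0, u0)\<close> at the origin gives
  a pair \<open>(- u0, - x0)\<close> that is monotonically related to the graph of \<open>T\<close>.
\<close>

lemma maximally_monotone_minus_fixed_point:
  fixes T :: "'a::{real_inner, banach} \<Rightarrow> 'a set"
  assumes "maximally_monotone T"
  obtains x where "- x \<in> T x"
proof -
  have mono: "monotone_operator T"
    and maxi: "(\<And>y v. v \<in> T y \<Longrightarrow> 0 \<le> inner (x - y) (u - v)) \<Longrightarrow> u \<in> T x" for x u
    using assms unfolding maximally_monotone_iff by blast+
  define E where "E = {w :: ('a \<times> 'a) \<times> real. \<forall>a v. v \<in> T a \<longrightarrow>
    inner (fst (fst w)) v + inner a (snd (fst w)) - inner a v \<le> snd w}"
  have "E = (\<Inter>a. \<Inter>v\<in>T a. {w. inner (fst (fst w)) v + inner a (snd (fst w)) - inner a v \<le> snd w})"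
    by (auto simp: E_def)
  then have "closed E"
    by (auto intro!: closed_INT closed_Collect_le continuous_intros)
  moreover have "convex E"
    unfolding convex_alt
  proof (intro ballI allI impI)
    fix w w' :: "('a \<times> 'a) \<times> real" and c :: real
    assume w: "w \<in> E" "w' \<in> E" and c: "0 \<le> c \<and> c \<le> 1"
    show "(1 - c) *\<^sub>R w + c *\<^sub>R w' \<in> E"
      unfolding E_def
    proof (intro CollectI allI impI)
      fix a v assume "v \<in> T a"
      with w have 1: "inner (fst (fst w)) v + inner a (snd (fst w)) - inner a v \<le> snd w"
        and 2: "inner (fst (fst w')) v + inner a (snd (fst w')) - inner a v \<le> snd w'"
        by (auto simp: E_def)
      have "(1 - c) * (inner (fst (fst w)) v + inner a (snd (fst w)) - inner a v)
          + c * (inner (fst (fst w')) v + inner a (snd (fst w')) - inner a v)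
          \<le> (1 - c) * snd w + c * snd w'"
        using c 1 2 by (intro add_mono mult_left_mono) auto
      then show "inner (fst (fst ((1 - c) *\<^sub>R w + c *\<^sub>R w'))) v
          + inner a (snd (fst ((1 - c) *\<^sub>R w + c *\<^sub>R w'))) - inner a v
          \<le> snd ((1 - c) *\<^sub>R w + c *\<^sub>R w')"
        by (simp add: inner_add_left inner_add_right algebra_simps)
    qed
  qed
  moreover have "E \<noteq> {}"
  proof -
    \<comment> \<open>If the graph were empty, \<open>(0, 0)\<close> would be vacuously related to
      it and hence belong to it.\<close>
    obtain a v where av: "v \<in> T a"
      using maxi[of 0 0] by blast
    have "((a, v), inner a v) \<in> E"
      using monotone_operatorD[OF mono av]
      by (auto simp: E_def inner_diff_left inner_diff_right algebra_simps)
    then show ?thesis by blast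
  qed
  \<comment> \<open>A pair in the graph is tested against itself; any other pair violates
    monotonicity against some element of the graph, which then witnesses the bound.\<close>
  moreover have pairing: "inner x u \<le> r" if "((x, u), r) \<in> E" for x u r
  proof (cases "u \<in> T x")
    case True
    then show ?thesis using that by (fastforce simp: E_def)
  next
    case False
    then obtain a v where "v \<in> T a" "inner (x - a) (u - v) < 0"
      using maxi[of x u] by force
    then show ?thesis
      using that by (force simp: E_def inner_diff_left inner_diff_right algebra_simps)
  qed
  moreover have "0 \<le> r + (norm q)\<^sup>2 / 2" if "(q, r) \<in> E" for q r
  proof -
    obtain x u where q: "q = (x, u)" by fastforce
    have "0 \<le> (norm (x + u))\<^sup>2" by simp
    then show ?thesis
      using pairing[of x u r] that
      by (simp add: q norm_Pair power2_norm_eq_inner inner_add_left inner_add_right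
          inner_commute[of u x] field_simps)
  qed
  ultimately obtain p r where prE: "(p, r) \<in> E"
    and var: "\<And>q s. (q, s) \<in> E \<Longrightarrow> r \<le> s + inner p (q - p)"
    using prox_variational_inequality[of E 0] by blast
  obtain x0 u0 where p: "p = (x0, u0)" by fastforce
  \<comment> \<open>The variational inequality is evaluated at \<open>((a, v), inner a v)\<close>, a
    point of \<open>E\<close> by monotonicity, and \<open>r\<close> is bounded below by
    \<open>inner x0 u0\<close>.\<close>
  have key: "(norm (x0 + u0))\<^sup>2 \<le> inner (- u0 - a) (- x0 - v)" if "v \<in> T a" for a v
  proof -
    have "((a, v), inner a v) \<in> E"
      using monotone_operatorD[OF mono that]
      by (auto simp: E_def inner_diff_left inner_diff_right algebra_simps)
    from var[OF this] pairing[of x0 u0 r] prE show ?thesis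
      by (simp add: p power2_norm_eq_inner inner_diff_left inner_diff_right
          inner_add_left inner_add_right inner_commute)
  qed
  have "- x0 \<in> T (- u0)"
    using key by (intro maxi) (meson order_trans zero_le_power2)
  \<comment> \<open>At the pair \<open>(- u0, - x0)\<close> itself the right-hand side of
    \<open>key\<close> is 0, which forces \<open>x0 + u0 = 0\<close>.\<close>
  moreover from key[OF this] have "- u0 = x0"
    by (simp add: add_eq_0_iff)
  ultimately show thesis by (intro that[of x0]) simp
qed

text \<open>Translating the argument of \<open>T\<close> by \<open>z\<close> reduces surjectivity of
  \<open>Id + T\<close> to the case of the value 0.\<close>

theorem minty:
  fixes T :: "'a::{real_inner, banach} \<Rightarrow> 'a set"
  assumes "maximally_monotone T"
  obtains x where "z - x \<in> T x"
proof -
  have "monotone_operator T"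
    and maxi: "(\<And>y v. v \<in> T y \<Longrightarrow> 0 \<le> inner (x - y) (u - v)) \<Longrightarrow> u \<in> T x" for x u
    using assms unfolding maximally_monotone_iff by blast+
  define S where "S x = T (x + z)" for x
  have "maximally_monotone S"
    unfolding maximally_monotone_iff
  proof (intro conjI allI impI)
    show "monotone_operator S"
      using monotone_operatorD[OF \<open>monotone_operator T\<close>]
      by (fastforce simp: S_def monotone_operator_def op_graph_def)
  next
    fix x u assume rel: "\<forall>y v. v \<in> S y \<longrightarrow> 0 \<le> inner (x - y) (u - v)"
    have "0 \<le> inner (x + z - y) (u - v)" if "v \<in> T y" for y v
    proof -
      have "v \<in> S (y - z)" using that by (simp add: S_def)
      with rel have "0 \<le> inner (x - (y - z)) (u - v)" by blast
      then show ?thesis by (simp add: algebra_simps)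
    qed
    then show "u \<in> S x" unfolding S_def by (rule maxi)
  qed
  then obtain x where "- x \<in> S x" by (rule maximally_monotone_minus_fixed_point)
  then show thesis by (intro that[of "x + z"]) (simp add: S_def)
qed

lemma monotone_resolvent_unique:
  assumes "monotone_operator T" "z - x \<in> T x" "z - x' \<in> T x'"
  shows "x = x'"
proof -
  have "0 \<le> inner (x - x') ((z - x) - (z - x'))"
    using monotone_operatorD assms by blast
  also have "(z - x) - (z - x') = - (x - x')" by simp
  finally have "inner (x - x') (x - x') \<le> 0" by (simp only: inner_minus_right)
  then show ?thesis by (metis eq_iff_diff_eq_0 inner_ge_zero inner_eq_zero_iff order_antisym)
qed

text \<open>Existence is Minty's theorem and uniqueness is monotonicity, so the description operator
  can be traded for an inclusion. All later uses of the resolvent go through this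
  equivalence.\<close>

lemma resolvent_eq_iff:
  fixes T :: "'a::{real_inner, banach} \<Rightarrow> 'a set"
  assumes "maximally_monotone T"
  shows "x = resolvent T z \<longleftrightarrow> z - x \<in> T x"
proof -
  have mem: "x \<in> op_inverse (\<lambda>x. {x} + T x) z \<longleftrightarrow> z - x \<in> T x" for x
    by (auto simp: op_inverse_def set_plus_def algebra_simps) (metis diff_add_cancel)
  have mono: "monotone_operator T" using assms by (simp add: maximally_monotone_def)
  obtain p where p: "z - p \<in> T p" using minty[OF assms] by blast
  have "resolvent T z = p"
    unfolding resolvent_def mem
    using p by (intro the_equality) (auto intro: monotone_resolvent_unique[OF mono])
  then show ?thesis
    using p by (auto intro: monotone_resolvent_unique[OF mono])
qed

lemma maximally_monotone_scale:
  fixes T :: "'a::real_inner \<Rightarrow> 'a set"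
  assumes "maximally_monotone T" "c > 0"
  shows "maximally_monotone (op_scale c T)"
  unfolding maximally_monotone_iff
proof (intro conjI allI impI)
  have "monotone_operator T"
    and maxi: "(\<And>y v. v \<in> T y \<Longrightarrow> 0 \<le> inner (x - y) (u - v)) \<Longrightarrow> u \<in> T x" for x u
    using assms unfolding maximally_monotone_iff by blast+
  have "0 \<le> inner (x - y) (c *\<^sub>R u - c *\<^sub>R v)" if "u \<in> T x" "v \<in> T y" for x y u v
    using monotone_operatorD[OF \<open>monotone_operator T\<close> that] \<open>c > 0\<close>
    by (simp flip: scaleR_diff_right)
  then show "monotone_operator (op_scale c T)"
    by (auto simp: monotone_operator_def op_graph_def op_scale_def)
  fix x u assume rel: "\<forall>y v. v \<in> op_scale c T y \<longrightarrow> 0 \<le> inner (x - y) (u - v)"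
  have "u /\<^sub>R c \<in> T x"
  proof (rule maxi)
    fix y v assume "v \<in> T y"
    then have "0 \<le> inner (x - y) (u - c *\<^sub>R v)" using rel by (auto simp: op_scale_def)
    also have "u - c *\<^sub>R v = c *\<^sub>R (u /\<^sub>R c - v)"
      using \<open>c > 0\<close> by (simp add: scaleR_diff_right)
    finally show "0 \<le> inner (x - y) (u /\<^sub>R c - v)"
      using \<open>c > 0\<close> by (simp add: zero_le_mult_iff)
  qed
  then show "u \<in> op_scale c T x"
    using \<open>c > 0\<close> by (auto simp: op_scale_def intro!: image_eqI[of _ _ "u /\<^sub>R c"])
qed

subsection \<open>Weak compactness along filters\<close>

text \<open>
  Tychonoff's theorem makes a finer filter converge against all functionals at once, so
  that no separability or diagonal argument is needed.
\<close>

lemma bounded_weakly_convergent_subfilter: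
  fixes X :: "'b \<Rightarrow> 'a::{real_inner, banach}"
  assumes "F \<noteq> bot" and bound: "\<And>k. norm (X k) \<le> M"
  shows "\<exists>F' l. F' \<noteq> bot \<and> F' \<le> F \<and> (\<forall>u. ((\<lambda>k. inner (X k) u) \<longlongrightarrow> inner l u) F')"
proof -
  define \<Phi> where "\<Phi> k = (\<lambda>u. inner (X k) u)" for k
  \<comment> \<open>By Cauchy-Schwarz all functionals \<open>\<Phi> k\<close> lie in this product of
    compact intervals.\<close>
  define K where "K = (\<Pi>\<^sub>E u\<in>(UNIV :: 'a set). {- (M * norm u) .. M * norm u})"
  have "compactin (product_topology (\<lambda>_::'a. euclideanreal) UNIV) K"
    unfolding K_def by (subst compactin_PiE) auto
  then have "compact K" by (simp add: euclidean_product_topology)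
  have "\<bar>inner (X k) u\<bar> \<le> M * norm u" for k u
    by (meson Cauchy_Schwarz_ineq2 bound mult_right_mono norm_ge_zero order_trans)
  then have \<Phi>K: "\<Phi> k \<in> K" for k
    by (auto simp: \<Phi>_def K_def abs_le_iff minus_le_iff)
  have "filtermap \<Phi> F \<noteq> bot" "eventually (\<lambda>f. f \<in> K) (filtermap \<Phi> F)"
    using \<open>F \<noteq> bot\<close> \<Phi>K by (auto simp: filtermap_bot_iff eventually_filtermap)
  then obtain \<phi> where "\<phi> \<in> K" and \<phi>: "inf (nhds \<phi>) (filtermap \<Phi> F) \<noteq> bot"
    using \<open>compact K\<close> unfolding compact_filter by blast
  \<comment> \<open>Refining \<open>F\<close> by the preimages of the neighbourhoods of the cluster
    point \<open>\<phi>\<close> forces \<open>\<Phi>\<close> to converge to it.\<close>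
  define F' where "F' = inf F (filtercomap \<Phi> (nhds \<phi>))"
  have "F' \<noteq> bot"
  proof
    assume "F' = bot"
    then obtain P Q where "eventually P F" "eventually Q (nhds \<phi>)" "\<And>k. P k \<Longrightarrow> \<not> Q (\<Phi> k)"
      by (auto simp: F'_def trivial_limit_def eventually_inf eventually_filtercomap)
    then have "eventually (\<lambda>f. \<not> Q f) (filtermap \<Phi> F)"
      by (auto simp: eventually_filtermap elim: eventually_mono)
    with \<open>eventually Q (nhds \<phi>)\<close> have "inf (nhds \<phi>) (filtermap \<Phi> F) = bot"
      unfolding trivial_limit_def eventually_inf by blast
    with \<phi> show False by simp
  qed
  have "(\<Phi> \<longlongrightarrow> \<phi>) F'"
    unfolding F'_def by (rule filterlim_mono[OF filterlim_filtercomap]) auto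
  then have lim: "((\<lambda>k. inner (X k) u) \<longlongrightarrow> \<phi> u) F'" for u
    using continuous_on_tendsto_compose[of UNIV "\<lambda>f. f u" \<Phi> \<phi> F']
    by (simp add: \<Phi>_def)
  \<comment> \<open>Linearity passes to pointwise limits and the bound comes from \<open>K\<close>,
    so Riesz represents the limit functional by a vector.\<close>
  have "bounded_linear \<phi>"
  proof (rule bounded_linear_intro)
    fix u v :: 'a and c :: real
    have "((\<lambda>k. inner (X k) (u + v)) \<longlongrightarrow> \<phi> u + \<phi> v) F'"
      unfolding inner_add_right by (intro tendsto_intros lim)
    then show "\<phi> (u + v) = \<phi> u + \<phi> v"
      using tendsto_unique[OF \<open>F' \<noteq> bot\<close> lim] by blast
    have "((\<lambda>k. inner (X k) (c *\<^sub>R u)) \<longlongrightarrow> c * \<phi> u) F'"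
      unfolding inner_scaleR_right by (intro tendsto_intros lim)
    then show "\<phi> (c *\<^sub>R u) = c *\<^sub>R \<phi> u"
      using tendsto_unique[OF \<open>F' \<noteq> bot\<close> lim] by simp
    show "norm (\<phi> u) \<le> norm u * M"
    proof -
      have "\<phi> u \<in> {- (M * norm u) .. M * norm u}"
        using PiE_mem[OF \<open>\<phi> \<in> K\<close>[unfolded K_def] UNIV_I] .
      then show ?thesis by (auto simp: abs_le_iff mult.commute)
    qed
  qed
  then obtain l where "\<And>u. \<phi> u = inner l u" using riesz_representation by blast
  then have "\<forall>u. ((\<lambda>k. inner (X k) u) \<longlongrightarrow> inner l u) F'" using lim by simp
  moreover have "F' \<le> F" by (simp add: F'_def)
  ultimately show ?thesis using \<open>F' \<noteq> bot\<close> by blast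
qed

text \<open>This is the filter form of the subsequence criterion: if \<open>f\<close> left a
  neighbourhood of \<open>l\<close> frequently, then \<open>G\<close> restricted to those indices
  would be a proper filter with no refinement along which \<open>f\<close> tends to
  \<open>l\<close>.\<close>

lemma tendsto_by_subfilters:
  assumes "\<And>F. F \<noteq> bot \<Longrightarrow> F \<le> G \<Longrightarrow> \<exists>F'. F' \<noteq> bot \<and> F' \<le> F \<and> (f \<longlongrightarrow> l) F'"
  shows "(f \<longlongrightarrow> l) G"
proof (rule topological_tendstoI, rule ccontr)
  fix S assume S: "open S" "l \<in> S" and neg: "\<not> (\<forall>\<^sub>F k in G. f k \<in> S)"
  define F where "F = inf G (principal {k. f k \<notin> S})"
  have "F \<noteq> bot" using neg by (auto simp: F_def trivial_limit_def eventually_inf_principal)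
  then obtain F' where F': "F' \<noteq> bot" "F' \<le> F" "(f \<longlongrightarrow> l) F'"
    using assms[of F] by (auto simp: F_def)
  have "\<forall>\<^sub>F k in F. f k \<notin> S" by (auto simp: F_def eventually_inf_principal)
  then have "\<forall>\<^sub>F k in F'. f k \<notin> S" using F'(2) by (rule filter_leD[rotated])
  moreover have "\<forall>\<^sub>F k in F'. f k \<in> S" using F'(3) S by (rule topological_tendstoD)
  ultimately have "\<forall>\<^sub>F k in F'. False" by eventually_elim simp
  with F'(1) show False by (simp add: trivial_limit_def)
qed

subsection \<open>The iteration with unit step size\<close>

lemma two_mult_le_weighted_squares:
  fixes a b t :: real
  assumes "0 \<le> t"
  shows "2 * t * a * b \<le> t * a\<^sup>2 + t * b\<^sup>2"
proof -
  have "0 \<le> t * (a - b)\<^sup>2" using assms by simp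
  then show ?thesis by (simp add: power2_diff algebra_simps)
qed

text \<open>The step size is absorbed into the operators and resolvents appear as inclusions. The
  inclusion for \<open>y\<close> starts at index 2, so that only natural indices occur;
  \<open>y 0\<close> and \<open>y 1\<close> act as starting values.\<close>

locale backward_forward_reflected_backward =
  fixes A C :: "'a::{real_inner, banach} \<Rightarrow> 'a set"
    and B :: "'a \<Rightarrow> 'a" and t :: real and x y z :: "nat \<Rightarrow> 'a"
  assumes A: "maximally_monotone A" and C: "maximally_monotone C"
    and B_mono: "0 \<le> inner (u - v) (B u - B v)"
    and B_lip: "norm (B u - B v) \<le> t * norm (u - v)"
    and t: "0 < t" "t < 1 / 8"
    and x_step: "z k - x k \<in> A (x k)"
    and y_step: "2 *\<^sub>R x (k + 2) - z (k + 2) - 2 *\<^sub>R B (y (k + 1)) + B (y k) - y (k + 2) \<in> C (y (k + 2))"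
    and z_step: "z (Suc k) = z k + y k - x k"
begin

section \<open>Nonexpansiveness and distance bounds for the iterates\<close>

lemma A_mono: "u \<in> A p \<Longrightarrow> v \<in> A q \<Longrightarrow> 0 \<le> inner (p - q) (u - v)"
  using A monotone_operatorD unfolding maximally_monotone_def by blast

lemma C_mono: "u \<in> C p \<Longrightarrow> v \<in> C q \<Longrightarrow> 0 \<le> inner (p - q) (u - v)"
  using C monotone_operatorD unfolding maximally_monotone_def by blast

definition residual :: "nat \<Rightarrow> real" where
  "residual k = norm (y k - x k)"

text \<open>
  The point \<open>p\<close> is a zero of \<open>A + B + C\<close>, and \<open>p + a\<close> is the corresponding stationary
  point of the governing sequence \<open>z\<close>.
\<close>

definition zero_pair :: "'a \<Rightarrow> 'a \<Rightarrow> bool" where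
  "zero_pair p a \<longleftrightarrow> a \<in> A p \<and> - a - B p \<in> C p"

text \<open>Since \<open>p\<close> is the resolvent of \<open>A\<close> at \<open>p + u\<close>,
  this is nonexpansiveness of \<open>Id - J\<close> for that resolvent \<open>J\<close>.\<close>

lemma A_complement_nonexpansive:
  assumes "u \<in> A p" "v \<in> A q"
  shows "norm (u - v) \<le> norm ((p + u) - (q + v))"
proof -
  have "(norm (u - v))\<^sup>2 + (norm (p - q))\<^sup>2 + 2 * inner (p - q) (u - v) = (norm ((p + u) - (q + v)))\<^sup>2"
    by (simp add: power2_norm_eq_inner inner_add_left inner_add_right inner_diff_left
        inner_diff_right inner_commute)
  then have "(norm (u - v))\<^sup>2 \<le> (norm ((p + u) - (q + v)))\<^sup>2"
    using A_mono[OF assms] zero_le_power2[of "norm (p - q)"] by linarith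
  then show ?thesis by (rule power2_le_imp_le) simp
qed

text \<open>With \<open>p\<close> the resolvent at \<open>p + u\<close>, the vector
  \<open>p - u\<close> is the reflected resolvent \<open>2 J - Id\<close> at that point.\<close>

lemma A_reflection_nonexpansive:
  assumes "u \<in> A p" "v \<in> A q"
  shows "norm ((p - u) - (q - v)) \<le> norm ((p + u) - (q + v))"
proof -
  have "(norm ((p - u) - (q - v)))\<^sup>2 + 4 * inner (p - q) (u - v) = (norm ((p + u) - (q + v)))\<^sup>2"
    by (simp add: power2_norm_eq_inner inner_add_left inner_add_right inner_diff_left
        inner_diff_right inner_commute)
  then have "(norm ((p - u) - (q - v)))\<^sup>2 \<le> (norm ((p + u) - (q + v)))\<^sup>2"
    using A_mono[OF assms] by linarith
  then show ?thesis by (rule power2_le_imp_le) simp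
qed

text \<open>The increment of \<open>y\<close> is the new residual vector minus the increment of
  \<open>z - x\<close>; the latter is bounded by the increment of \<open>z\<close>, which is the old
  residual vector.\<close>

lemma y_increment_le: "norm (y (Suc k) - y k) \<le> residual (Suc k) + residual k"
proof -
  have "y (Suc k) - y k = (y (Suc k) - x (Suc k)) - ((z (Suc k) - x (Suc k)) - (z k - x k))"
    by (simp add: z_step)
  then have "norm (y (Suc k) - y k) \<le>
      residual (Suc k) + norm ((z (Suc k) - x (Suc k)) - (z k - x k))"
    unfolding residual_def by (metis norm_triangle_ineq4)
  also have "norm ((z (Suc k) - x (Suc k)) - (z k - x k)) \<le> residual k"
    using A_complement_nonexpansive[OF x_step x_step, of "Suc k" k]
    by (simp add: z_step residual_def)
  finally show ?thesis by simp
qed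

text \<open>Writing twice \<open>y k - p\<close> through the reflected point keeps the coefficient
  of the residual at 1; the triangle inequality through \<open>x k\<close> would give 2.\<close>

lemma y_distance_le:
  assumes "zero_pair p a"
  shows "norm (y k - p) \<le> norm (z (Suc k) - (p + a)) + residual k"
proof -
  have a: "a \<in> A p" using assms by (simp add: zero_pair_def)
  define R where "R = (x k - (z k - x k)) - (p - a)"
  have "norm R \<le> norm (z k - (p + a))"
    using A_reflection_nonexpansive[OF x_step a, of k] by (simp add: R_def)
  also have "\<dots> = norm ((z (Suc k) - (p + a)) - (y k - x k))"
    by (simp add: z_step algebra_simps)
  also have "\<dots> \<le> norm (z (Suc k) - (p + a)) + residual k"
    unfolding residual_def by (rule norm_triangle_ineq4)
  finally have R: "norm R \<le> norm (z (Suc k) - (p + a)) + residual k" .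
  have "2 *\<^sub>R (y k - p) = (z (Suc k) - (p + a)) + ((y k - x k) + R)"
    by (simp add: R_def z_step scaleR_2 algebra_simps)
  then have "2 * norm (y k - p) = norm ((z (Suc k) - (p + a)) + ((y k - x k) + R))"
    by (metis norm_scaleR abs_numeral)
  also have "\<dots> \<le> norm (z (Suc k) - (p + a)) + (residual k + norm R)"
    unfolding residual_def by (meson add_left_mono norm_triangle_ineq order_trans)
  finally show ?thesis using R by simp
qed

section \<open>The Lyapunov energy and its decrease\<close>

definition cross :: "'a \<Rightarrow> nat \<Rightarrow> real" where
  "cross p k = 2 * inner (y (Suc k) - p) (B (y (Suc k)) - B (y k))"

text \<open>
  The weights \<open>6 * t\<close> and \<open>2 * t\<close> are those that make the residual terms of
  \<open>B_increment_inner_le\<close> telescope, at the total cost of \<open>8 * t < 1\<close>.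
\<close>

definition energy :: "'a \<Rightarrow> 'a \<Rightarrow> nat \<Rightarrow> real" where
  "energy p a k = (norm (z (k + 2) - (p + a)))\<^sup>2 - cross p k
    + 6 * t * (residual (k + 1))\<^sup>2 + 2 * t * (residual k)\<^sup>2"

text \<open>Cauchy-Schwarz and the Lipschitz bound leave a product of two consecutive increments of
  \<open>y\<close>. It is split into squares, and each increment is replaced by two residuals; the
  middle residual occurs in both, hence the weight 4.\<close>

lemma B_increment_inner_le:
  "- 2 * inner (y (k + 2) - y (k + 1)) (B (y (k + 1)) - B (y k))
    \<le> t * (2 * (residual (k + 2))\<^sup>2 + 4 * (residual (k + 1))\<^sup>2 + 2 * (residual k)\<^sup>2)"
proof -
  define d1 d0 where "d1 = norm (y (k + 2) - y (k + 1))" and "d0 = norm (y (k + 1) - y k)"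
  have sq: "d\<^sup>2 \<le> 2 * r\<^sup>2 + 2 * s\<^sup>2" if "0 \<le> d" "d \<le> r + s" for d r s :: real
  proof -
    have "d\<^sup>2 \<le> (r + s)\<^sup>2" using that by (rule power_mono[rotated])
    moreover have "0 \<le> (r - s)\<^sup>2" by simp
    ultimately show ?thesis by (simp add: power2_sum power2_diff)
  qed
  have d1: "d1\<^sup>2 \<le> 2 * (residual (k + 2))\<^sup>2 + 2 * (residual (k + 1))\<^sup>2"
    using y_increment_le[of "k + 1"] by (intro sq) (auto simp: d1_def)
  have d0: "d0\<^sup>2 \<le> 2 * (residual (k + 1))\<^sup>2 + 2 * (residual k)\<^sup>2"
    using y_increment_le[of k] by (intro sq) (auto simp: d0_def)
  have "- inner (y (k + 2) - y (k + 1)) (B (y (k + 1)) - B (y k))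
      \<le> d1 * norm (B (y (k + 1)) - B (y k))"
    unfolding d1_def
    using Cauchy_Schwarz_ineq2[of "y (k + 2) - y (k + 1)" "B (y (k + 1)) - B (y k)"] by linarith
  also have "\<dots> \<le> d1 * (t * d0)"
    unfolding d0_def d1_def by (intro mult_left_mono B_lip) simp
  also have "\<dots> = t * d1 * d0" by simp
  finally have "- 2 * inner (y (k + 2) - y (k + 1)) (B (y (k + 1)) - B (y k)) \<le> 2 * t * d1 * d0"
    by linarith
  also have "\<dots> \<le> t * d1\<^sup>2 + t * d0\<^sup>2"
    using t by (intro two_mult_le_weighted_squares) simp
  also have "\<dots> = t * (d1\<^sup>2 + d0\<^sup>2)" by (simp add: distrib_left)
  also have "\<dots> \<le> t * (2 * (residual (k + 2))\<^sup>2 + 4 * (residual (k + 1))\<^sup>2 + 2 * (residual k)\<^sup>2)"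
    using t d1 d0 by (intro mult_left_mono) auto
  finally show ?thesis .
qed

lemma energy_decrease:
  assumes "zero_pair p a"
  shows "energy p a (Suc k) \<le> energy p a k - (1 - 8 * t) * (residual (k + 2))\<^sup>2"
proof -
  let ?n = "k + 2"
  define Z X Y b where "Z = z ?n - (p + a)" and "X = x ?n - p" and "Y = y ?n - p"
    and "b = 2 *\<^sub>R B (y (k + 1)) - B (y k) - B p"
  have a: "a \<in> A p" and c: "- a - B p \<in> C p" using assms by (auto simp: zero_pair_def)
  have "z ?n - x ?n - a = Z - X" by (simp add: Z_def X_def)
  then have "0 \<le> inner X (Z - X)"
    using A_mono[OF x_step a, of ?n] by (simp only: X_def)
  moreover have "2 *\<^sub>R x ?n - z ?n - 2 *\<^sub>R B (y (k + 1)) + B (y k) - y ?n - (- a - B p)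
      = 2 *\<^sub>R X - Z - Y - b"
    by (simp add: X_def Y_def Z_def b_def algebra_simps scaleR_2)
  then have "0 \<le> inner Y (2 *\<^sub>R X - Z - Y - b)"
    using C_mono[OF y_step c, of k] by (simp only: Y_def)
  moreover have "z (Suc ?n) - (p + a) = Z + (Y - X)"
    by (simp only: z_step Z_def X_def Y_def) simp
  then have "(norm (z (Suc ?n) - (p + a)))\<^sup>2
      = (norm Z)\<^sup>2 + 2 * inner Z (Y - X) + (norm (Y - X))\<^sup>2"
    by (simp only: norm_add_squared)
  moreover have "norm (Y - X) = residual ?n"
    by (simp add: X_def Y_def residual_def)
  moreover have "(norm (Y - X))\<^sup>2 = inner Y Y - 2 * inner X Y + inner X X"
    by (simp add: power2_norm_eq_inner inner_diff_left inner_diff_right inner_commute)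
  \<comment> \<open>Twice the sum of the two monotonicity inequalities contributes minus two squared
    residuals, of which the expansion of the square gives one back.\<close>
  ultimately have main: "(norm (z (Suc ?n) - (p + a)))\<^sup>2
      \<le> (norm Z)\<^sup>2 - (residual ?n)\<^sup>2 - 2 * inner Y b"
    by (simp add: inner_add_right inner_diff_right
        inner_commute[of Z X] inner_commute[of Z Y] inner_commute[of Y X])
  have "0 \<le> inner Y (B (y ?n) - B p)" unfolding Y_def by (rule B_mono)
  \<comment> \<open>The extrapolation in \<open>b\<close> misses \<open>B (y ?n)\<close> by a
    difference of two consecutive increments of \<open>B\<close>. Splitting \<open>Y\<close> at
    \<open>y (k + 1)\<close> in the older one produces two telescoping cross terms and a
    remainder.\<close>
  moreover have "inner Y (B (y ?n) - B p) - inner Y b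
      = inner Y (B (y ?n) - B (y (k + 1))) - inner (y (k + 1) - p) (B (y (k + 1)) - B (y k))
        - inner (y ?n - y (k + 1)) (B (y (k + 1)) - B (y k))"
    by (simp add: Y_def b_def inner_diff_left inner_diff_right algebra_simps)
  moreover have "cross p (Suc k) = 2 * inner Y (B (y ?n) - B (y (k + 1)))"
    "cross p k = 2 * inner (y (k + 1) - p) (B (y (k + 1)) - B (y k))"
    by (simp_all add: cross_def Y_def)
  ultimately have "- 2 * inner Y b \<le> cross p (Suc k) - cross p k
      - 2 * inner (y ?n - y (k + 1)) (B (y (k + 1)) - B (y k))"
    by linarith
  with main B_increment_inner_le[of k] have "(norm (z (Suc ?n) - (p + a)))\<^sup>2 \<le> (norm Z)\<^sup>2
      - (residual ?n)\<^sup>2 + cross p (Suc k) - cross p k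
      + t * (2 * (residual (k + 2))\<^sup>2 + 4 * (residual (k + 1))\<^sup>2 + 2 * (residual k)\<^sup>2)"
    by linarith
  then show ?thesis
    by (simp add: energy_def Z_def algebra_simps)
qed

lemma cross_le:
  assumes "zero_pair p a"
  shows "\<bar>cross p k\<bar> \<le> 2 * t * (norm (z (k + 2) - (p + a)) + residual (k + 1))
    * (residual (k + 1) + residual k)"
proof -
  have "\<bar>inner (y (Suc k) - p) (B (y (Suc k)) - B (y k))\<bar>
      \<le> norm (y (Suc k) - p) * norm (B (y (Suc k)) - B (y k))"
    by (rule Cauchy_Schwarz_ineq2)
  also have "\<dots> \<le> norm (y (Suc k) - p) * (t * norm (y (Suc k) - y k))"
    by (intro mult_left_mono B_lip) simp
  also have "\<dots> \<le> (norm (z (k + 2) - (p + a)) + residual (k + 1))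
      * (t * (residual (k + 1) + residual k))"
    using y_distance_le[OF assms, of "Suc k"] y_increment_le[of k] t
    by (intro mult_mono) (auto simp: residual_def)
  finally have "2 * \<bar>inner (y (Suc k) - p) (B (y (Suc k)) - B (y k))\<bar>
      \<le> 2 * ((norm (z (k + 2) - (p + a)) + residual (k + 1)) * (t * (residual (k + 1) + residual k)))"
    by (rule mult_left_mono) simp
  then show ?thesis by (simp only: cross_def abs_mult abs_numeral mult.assoc mult.left_commute[of t])
qed

text \<open>Young's inequality bounds the cross term by \<open>2 * t\<close> times the squared
  distance plus residual terms with weights \<open>4 * t\<close> and \<open>2 * t\<close>, which the
  energy dominates; \<open>t < 1 / 8\<close> leaves the factor 3/4.\<close>

lemma energy_ge:
  assumes "zero_pair p a"
  shows "3 / 4 * (norm (z (k + 2) - (p + a)))\<^sup>2 \<le> energy p a k"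
proof -
  define Z r s where "Z = norm (z (k + 2) - (p + a))" and "r = residual (k + 1)"
    and "s = residual k"
  have "cross p k \<le> 2 * t * (Z + r) * (r + s)"
    using cross_le[OF assms, of k] unfolding Z_def r_def s_def by linarith
  also have "\<dots> = 2 * t * Z * r + 2 * t * Z * s + 2 * t * r * s + 2 * t * r\<^sup>2"
    by (simp add: algebra_simps power2_eq_square)
  also have "\<dots> \<le> (t * Z\<^sup>2 + t * r\<^sup>2) + (t * Z\<^sup>2 + t * s\<^sup>2) + (t * r\<^sup>2 + t * s\<^sup>2) + 2 * t * r\<^sup>2"
    using t by (intro add_mono two_mult_le_weighted_squares order_refl) auto
  finally have cross: "cross p k \<le> 2 * (t * Z\<^sup>2) + 4 * (t * r\<^sup>2) + 2 * (t * s\<^sup>2)" by simp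
  have "t * Z\<^sup>2 \<le> 1 / 8 * Z\<^sup>2"
    using t by (intro mult_right_mono) auto
  moreover have "0 \<le> t * r\<^sup>2" using t by simp
  ultimately show ?thesis
    using cross unfolding energy_def Z_def[symmetric] r_def[symmetric] s_def[symmetric]
    by linarith
qed

section \<open>Vanishing residuals and convergent distances\<close>

lemma energy_convergent:
  assumes "zero_pair p a"
  shows "convergent (energy p a)"
proof (rule Bseq_monoseq_convergent)
  have dec: "energy p a (Suc k) \<le> energy p a k" for k
  proof -
    have "0 \<le> (1 - 8 * t) * (residual (k + 2))\<^sup>2" using t by simp
    with energy_decrease[OF assms, of k] show ?thesis by linarith
  qed
  then have "decseq (energy p a)" by (rule decseq_SucI)
  then show "monoseq (energy p a)" by (rule decseq_imp_monoseq)
  have "0 \<le> energy p a k" for k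
    using energy_ge[OF assms, of k] by (meson order_trans zero_le_power2 mult_nonneg_nonneg divide_nonneg_nonneg zero_le_numeral)
  moreover have "energy p a k \<le> energy p a 0" for k
    using \<open>decseq (energy p a)\<close> by (simp add: decseqD)
  ultimately show "Bseq (energy p a)"
    by (intro BseqI'[of _ "energy p a 0"]) simp
qed

lemma residual_tendsto_0:
  assumes "zero_pair p a"
  shows "residual \<longlonglongrightarrow> 0"
proof -
  obtain l where l: "energy p a \<longlonglongrightarrow> l"
    using energy_convergent[OF assms] by (auto simp: convergent_def)
  then have "(\<lambda>k. (energy p a k - energy p a (Suc k)) / (1 - 8 * t)) \<longlonglongrightarrow> (l - l) / (1 - 8 * t)"
    using t by (intro tendsto_intros LIMSEQ_Suc) auto
  then have lim: "(\<lambda>k. (energy p a k - energy p a (Suc k)) / (1 - 8 * t)) \<longlonglongrightarrow> 0" by simp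
  have "(residual (k + 2))\<^sup>2 \<le> (energy p a k - energy p a (Suc k)) / (1 - 8 * t)" for k
    using energy_decrease[OF assms, of k] t by (simp add: pos_le_divide_eq mult.commute)
  then have "(\<lambda>k. (residual (k + 2))\<^sup>2) \<longlonglongrightarrow> 0"
    by (intro tendsto_sandwich[OF _ _ tendsto_const lim]) auto
  then have "(\<lambda>k. sqrt ((residual (k + 2))\<^sup>2)) \<longlonglongrightarrow> sqrt 0"
    by (rule tendsto_real_sqrt)
  then have "(\<lambda>k. residual (k + 2)) \<longlonglongrightarrow> 0"
    by (simp add: residual_def)
  then show ?thesis by (rule LIMSEQ_offset)
qed

lemma difference_tendsto_0:
  assumes "zero_pair p a"
  shows "(\<lambda>k. y k - x k) \<longlonglongrightarrow> 0"
  using residual_tendsto_0[OF assms] unfolding residual_def[abs_def] by (simp add: tendsto_norm_zero_iff)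

lemma z_bounded:
  assumes "zero_pair p a"
  obtains M where "\<And>k. norm (z k) \<le> M"
proof -
  have "Bseq (energy p a)" using energy_convergent[OF assms] by (rule convergent_imp_Bseq)
  then obtain K where K: "\<And>k. norm (energy p a k) \<le> K" by (auto simp: Bseq_def)
  have "norm (z (k + 2)) \<le> sqrt (4 / 3 * K) + norm (p + a)" for k
  proof -
    have "energy p a k \<le> K" using K[of k] by simp
    then have "(norm (z (k + 2) - (p + a)))\<^sup>2 \<le> 4 / 3 * K"
      using energy_ge[OF assms, of k] by linarith
    then have "norm (z (k + 2) - (p + a)) \<le> sqrt (4 / 3 * K)" by (rule real_le_rsqrt)
    then show ?thesis using norm_triangle_sub[of "z (k + 2)" "p + a"] by linarith
  qed
  then have "Bseq (\<lambda>k. z (k + 2))" by (rule BseqI')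
  then have "Bseq z" by (rule Bseq_offset)
  then show thesis using that by (auto simp: Bseq_def)
qed

text \<open>The energy converges and its corrections vanish: the residuals tend to 0, and the cross
  term is at most a bounded factor times residuals.\<close>

lemma z_distance_convergent:
  assumes "zero_pair p a"
  shows "convergent (\<lambda>k. (norm (z k - (p + a)))\<^sup>2)"
proof -
  obtain l where l: "energy p a \<longlonglongrightarrow> l"
    using energy_convergent[OF assms] by (auto simp: convergent_def)
  obtain M where M: "\<And>k. norm (z k) \<le> M" using z_bounded[OF assms] by blast
  note r0 = residual_tendsto_0[OF assms]
  note r1 = LIMSEQ_ignore_initial_segment[OF r0, of 1]
  have "norm (cross p k) \<le> 2 * t * (M + norm (p + a) + residual (k + 1))
      * (residual (k + 1) + residual k)" for k
  proof -
    have "norm (z (k + 2) - (p + a)) \<le> M + norm (p + a)"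
      using norm_triangle_ineq4[of "z (k + 2)" "p + a"] M[of "k + 2"] by linarith
    then have "2 * t * (norm (z (k + 2) - (p + a)) + residual (k + 1)) * (residual (k + 1) + residual k)
      \<le> 2 * t * (M + norm (p + a) + residual (k + 1)) * (residual (k + 1) + residual k)"
      using t by (intro mult_right_mono mult_left_mono add_mono) (auto simp: residual_def)
    with cross_le[OF assms, of k] show ?thesis by simp
  qed
  moreover have "(\<lambda>k. 2 * t * (M + norm (p + a) + residual (k + 1))
      * (residual (k + 1) + residual k)) \<longlonglongrightarrow> 2 * t * (M + norm (p + a) + 0) * (0 + 0)"
    by (intro tendsto_intros r0 r1)
  ultimately have cross0: "cross p \<longlonglongrightarrow> 0"
    by (intro Lim_null_comparison[of "cross p"]) auto
  have "(\<lambda>k. energy p a k + cross p k - 6 * t * (residual (k + 1))\<^sup>2 - 2 * t * (residual k)\<^sup>2)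
      \<longlonglongrightarrow> l + 0 - 6 * t * 0\<^sup>2 - 2 * t * 0\<^sup>2"
    by (intro tendsto_intros l cross0 r0 r1)
  then have "(\<lambda>k. (norm (z (k + 2) - (p + a)))\<^sup>2) \<longlonglongrightarrow> l"
    by (simp add: energy_def)
  then have "(\<lambda>k. (norm (z k - (p + a)))\<^sup>2) \<longlonglongrightarrow> l" by (rule LIMSEQ_offset)
  then show ?thesis by (auto simp: convergent_def)
qed

lemma iterates_bounded:
  assumes "zero_pair p a"
  obtains M where "\<And>k. norm (z k) \<le> M" "\<And>k. norm (x k) \<le> M" "\<And>k. norm (y k) \<le> M"
proof -
  obtain K where K: "\<And>k. norm (z k) \<le> K" using z_bounded[OF assms] by blast
  have "a \<in> A p" using assms by (simp add: zero_pair_def)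
  have w: "norm (z k - x k) \<le> K + norm (p + a) + norm a" for k
  proof -
    have "norm (z k - x k) \<le> norm (z k - x k - a) + norm a"
      using norm_triangle_ineq[of "z k - x k - a" a] by simp
    also have "norm (z k - x k - a) \<le> norm (z k - (p + a))"
      using A_complement_nonexpansive[OF x_step \<open>a \<in> A p\<close>, of k] by simp
    also have "\<dots> \<le> K + norm (p + a)"
      using norm_triangle_ineq4[of "z k" "p + a"] K[of k] by linarith
    finally show ?thesis by simp
  qed
  have x: "norm (x k) \<le> 2 * K + norm (p + a) + norm a" for k
    using norm_triangle_ineq4[of "z k" "z k - x k"] w[of k] K[of k] by simp
  have y: "norm (y k) \<le> 4 * K + norm (p + a) + norm a" for k
  proof -
    have "y k = (z (Suc k) - z k) + x k" by (simp add: z_step)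
    then have "norm (y k) \<le> (norm (z (Suc k)) + norm (z k)) + norm (x k)"
      by (metis norm_triangle_mono norm_triangle_ineq4 order_refl)
    then show ?thesis using K[of k] K[of "Suc k"] x[of k] by simp
  qed
  have "0 \<le> K" using K[of 0] norm_ge_zero order_trans by blast
  show thesis
  proof (rule that[of "4 * K + norm (p + a) + norm a"])
    show "norm (z k) \<le> 4 * K + norm (p + a) + norm a" for k
      using K[of k] \<open>0 \<le> K\<close> norm_ge_zero[of "p + a"] norm_ge_zero[of a] by linarith
    show "norm (x k) \<le> 4 * K + norm (p + a) + norm a" for k
      using x[of k] \<open>0 \<le> K\<close> by linarith
  qed (rule y)
qed

section \<open>Identification of weak cluster points\<close>

lemma resolvent_C_add_B:
  obtains c where "q - c - B c \<in> C c"
proof -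
  define J where "J = resolvent C"
  have J: "u - J u \<in> C (J u)" for u
    using resolvent_eq_iff[OF C, of "J u" u] by (simp add: J_def)
  have nonexp: "norm (J u - J v) \<le> norm (u - v)" for u v
  proof -
    have "0 \<le> inner (J u - J v) ((u - J u) - (v - J v))" by (rule C_mono[OF J J])
    then have "(norm (J u - J v))\<^sup>2 \<le> inner (J u - J v) (u - v)"
      by (simp add: power2_norm_eq_inner inner_diff_right algebra_simps)
    also have "\<dots> \<le> norm (J u - J v) * norm (u - v)" by (rule norm_cauchy_schwarz)
    finally have "norm (J u - J v) * norm (J u - J v) \<le> norm (J u - J v) * norm (u - v)"
      by (simp add: power2_eq_square)
    then show ?thesis
      by (cases "norm (J u - J v) = 0") (auto simp: mult_le_cancel_left)
  qed
  have "dist (J (q - B u)) (J (q - B v)) \<le> t * dist u v" for u v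
  proof -
    have "norm (J (q - B u) - J (q - B v)) \<le> norm (B v - B u)"
      using nonexp[of "q - B u" "q - B v"] by simp
    also have "\<dots> \<le> t * norm (u - v)" using B_lip[of v u] by (simp add: norm_minus_commute)
    finally show ?thesis by (simp add: dist_norm)
  qed
  \<comment> \<open>The map sending \<open>c\<close> to \<open>J (q - B c)\<close> is a contraction
    because \<open>J\<close> is nonexpansive and \<open>t < 1\<close>; its fixed point is the
    resolvent point of \<open>C + B\<close> at \<open>q\<close>.\<close>
  then have "\<exists>!c\<in>UNIV. J (q - B c) = c"
    using t by (intro Banach_fix[of UNIV t]) (auto simp: complete_UNIV)
  then obtain c where "J (q - B c) = c" by blast
  with J[of "q - B c"] show thesis by (intro that[of c]) (simp add: algebra_simps)
qed

text \<open>
  Testing monotonicity at the resolvent points of the two weak limits replaces the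
  maximality of \<open>C + B\<close> and the demiclosedness principle.
\<close>

lemma weak_limit_point:
  assumes zero: "zero_pair p a" and F: "F \<noteq> bot" "F \<le> sequentially"
    and z_lim: "\<And>u. ((\<lambda>k. inner (z k) u) \<longlongrightarrow> inner zb u) F"
    and x_lim: "\<And>u. ((\<lambda>k. inner (x k) u) \<longlongrightarrow> inner xb u) F"
  shows "zero_pair xb (zb - xb)"
proof -
  obtain M where M: "\<And>k. norm (z k) \<le> M" "\<And>k. norm (x k) \<le> M" "\<And>k. norm (y k) \<le> M"
    using iterates_bounded[OF zero] by blast
  note r0 = residual_tendsto_0[OF zero]
  define w where "w k = z k - x k" for k
  \<comment> \<open>Natural subtraction truncates at 0, so membership of \<open>c k\<close> in
    \<open>C (y k)\<close> is claimed only from index 2 on.\<close>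
  define c where "c k = 2 *\<^sub>R x k - z k - 2 *\<^sub>R B (y (k - 1)) + B (y (k - 2)) - y k" for k
  define v where "v k = c k + B (y k)" for k
  have c_mem: "c k \<in> C (y k)" if "k \<ge> 2" for k
  proof -
    have "k - 2 + 2 = k" "k - 2 + 1 = k - 1" using that by simp_all
    then show ?thesis using y_step[of "k - 2"] by (simp only: c_def)
  qed
  \<comment> \<open>The sum of the selected values of \<open>A\<close> and \<open>C + B\<close>
    equals \<open>x - y\<close> plus a second difference of \<open>B\<close> along \<open>y\<close>,
    all controlled by residuals.\<close>
  have "(\<lambda>k. w (k + 2) + v (k + 2)) \<longlonglongrightarrow> 0"
  proof (rule Lim_null_comparison[OF always_eventually], intro allI)
    fix k
    have "w (k + 2) + v (k + 2) = (x (k + 2) - y (k + 2))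
        + ((B (y (k + 2)) - B (y (k + 1))) - (B (y (k + 1)) - B (y k)))"
      by (simp add: w_def v_def c_def scaleR_2 algebra_simps)
    then have "norm (w (k + 2) + v (k + 2)) \<le> norm (x (k + 2) - y (k + 2))
        + (norm (B (y (k + 2)) - B (y (k + 1))) + norm (B (y (k + 1)) - B (y k)))"
      by (metis norm_triangle_mono norm_triangle_ineq4 order_refl)
    also have "\<dots> \<le> residual (k + 2) + (t * (residual (k + 2) + residual (k + 1))
        + t * (residual (k + 1) + residual k))"
    proof (intro add_mono)
      show "norm (x (k + 2) - y (k + 2)) \<le> residual (k + 2)"
        by (simp add: residual_def norm_minus_commute)
      have Bd: "norm (B (y (Suc j)) - B (y j)) \<le> t * (residual (Suc j) + residual j)" for j
        using B_lip[of "y (Suc j)" "y j"] mult_left_mono[OF y_increment_le[of j], of t] t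
        by linarith
      show "norm (B (y (k + 2)) - B (y (k + 1))) \<le> t * (residual (k + 2) + residual (k + 1))"
        using Bd[of "k + 1"] by simp
      show "norm (B (y (k + 1)) - B (y k)) \<le> t * (residual (k + 1) + residual k)"
        using Bd[of k] by simp
    qed
    finally show "norm (w (k + 2) + v (k + 2)) \<le> residual (k + 2)
        + (t * (residual (k + 2) + residual (k + 1)) + t * (residual (k + 1) + residual k))" .
  next
    have "(\<lambda>k. residual (k + 2) + (t * (residual (k + 2) + residual (k + 1))
        + t * (residual (k + 1) + residual k))) \<longlonglongrightarrow> 0 + (t * (0 + 0) + t * (0 + 0))"
      by (intro tendsto_intros r0 LIMSEQ_ignore_initial_segment)
    then show "(\<lambda>k. residual (k + 2) + (t * (residual (k + 2) + residual (k + 1))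
        + t * (residual (k + 1) + residual k))) \<longlonglongrightarrow> 0" by simp
  qed
  then have wv: "(\<lambda>k. w k + v k) \<longlonglongrightarrow> 0" by (rule LIMSEQ_offset)
  have null: "((\<lambda>k. inner (f k) (g k)) \<longlongrightarrow> 0) F"
    if "f \<longlonglongrightarrow> 0" "\<And>k. norm (g k) \<le> K" for f g :: "nat \<Rightarrow> 'a" and K
  proof (rule Lim_null_comparison[OF always_eventually])
    show "\<forall>k. norm (inner (f k) (g k)) \<le> norm (f k) * K"
      using that(2) by (metis real_norm_def Cauchy_Schwarz_ineq2 mult_left_mono norm_ge_zero order_trans)
    show "((\<lambda>k. norm (f k) * K) \<longlongrightarrow> 0) F"
      using tendsto_mult[OF tendsto_norm[OF that(1)] tendsto_const, of K] F(2)
      by (auto intro: tendsto_mono)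
  qed
  have yx0: "(\<lambda>k. y k - x k) \<longlonglongrightarrow> 0"
    by (rule difference_tendsto_0[OF zero])
  have xy0: "(\<lambda>k. x k - y k) \<longlonglongrightarrow> 0"
    using tendsto_minus[OF yx0] by simp
  have y_lim: "((\<lambda>k. inner (y k) u) \<longlongrightarrow> inner xb u) F" for u
    using tendsto_diff[OF x_lim[of u] null[OF xy0, of "\<lambda>_. u" "norm u"]]
    by (simp add: inner_diff_left)
  have w_lim: "((\<lambda>k. inner (w k) u) \<longlongrightarrow> inner (zb - xb) u) F" for u
    unfolding w_def inner_diff_left by (intro tendsto_intros z_lim x_lim)
  have v_lim: "((\<lambda>k. inner (v k) u) \<longlongrightarrow> - inner (zb - xb) u) F" for u
    using tendsto_diff[OF null[OF wv, of "\<lambda>_. u" "norm u"] w_lim[of u]]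
    by (simp add: inner_add_left)
  \<comment> \<open>The test points are the resolvent points of \<open>A\<close> at
    \<open>zb\<close> and of \<open>C + B\<close> at \<open>2 *\<^sub>R xb - zb\<close>, the weak
    limits of \<open>z\<close> and of \<open>2 *\<^sub>R x k - z k\<close>.\<close>
  obtain a0 where a0: "zb - a0 \<in> A a0" using minty[OF A] by blast
  obtain c0 where c0: "2 *\<^sub>R xb - zb - c0 - B c0 \<in> C c0" by (rule resolvent_C_add_B)
  define a1 c1 where "a1 = zb - a0" and "c1 = 2 *\<^sub>R xb - zb - c0"
  \<comment> \<open>\<open>G k\<close> is the sum of the three monotonicity products, rearranged so
    that each product of two iterates has a strongly null factor; all other nonconstant terms are
    linear in one iterate and pass to weak limits.\<close>
  define G where "G k = inner (x k - y k) (w k) + inner (w k + v k) (y k)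
      - inner (x k) a1 - inner (w k) a0 + inner a0 a1
      - inner (y k) c1 - inner (v k) c0 + inner c0 c1" for k
  have w_bound: "norm (w k) \<le> M + M" for k
    unfolding w_def using norm_triangle_ineq4[of "z k" "x k"] M(1)[of k] M(2)[of k] by linarith
  have "0 \<le> G k" if "k \<ge> 2" for k
  proof -
    have "0 \<le> inner (x k - a0) (w k - a1)"
      unfolding w_def a1_def by (rule A_mono[OF x_step a0])
    moreover have "0 \<le> inner (y k - c0) (c k - (c1 - B c0))"
      unfolding c1_def by (rule C_mono[OF c_mem[OF that] c0])
    moreover have "0 \<le> inner (y k - c0) (B (y k) - B c0)" by (rule B_mono)
    moreover have "inner (x k - a0) (w k - a1) + inner (y k - c0) (c k - (c1 - B c0))
        + inner (y k - c0) (B (y k) - B c0) = G k"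
      by (simp add: G_def v_def inner_diff_left inner_diff_right inner_add_left inner_add_right
          inner_commute[of a0 "w k"] inner_commute[of c0 "c k"] inner_commute[of c0 "B (y k)"]
          inner_commute[of "w k" "y k"] inner_commute[of "c k" "y k"]
          inner_commute[of "B (y k)" "y k"])
    ultimately show ?thesis by linarith
  qed
  moreover have "\<forall>\<^sub>F k in F. k \<ge> 2"
    using F(2) eventually_ge_at_top[of "2::nat"] by (rule filter_leD)
  ultimately have G_ge: "\<forall>\<^sub>F k in F. 0 \<le> G k" by (auto elim: eventually_mono)
  have "(G \<longlongrightarrow> 0 + 0 - inner xb a1 - inner (zb - xb) a0 + inner a0 a1
      - inner xb c1 - (- inner (zb - xb) c0) + inner c0 c1) F"
    unfolding G_def
    by (intro tendsto_intros null[OF xy0 w_bound] null[OF wv M(3)] x_lim w_lim y_lim v_lim)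
  then have "0 \<le> 0 + 0 - inner xb a1 - inner (zb - xb) a0 + inner a0 a1
      - inner xb c1 - (- inner (zb - xb) c0) + inner c0 c1"
    by (rule tendsto_lowerbound[OF _ G_ge F(1)])
  also have "\<dots> = - (norm (xb - a0))\<^sup>2 - (norm (xb - c0))\<^sup>2"
    by (simp add: a1_def c1_def power2_norm_eq_inner inner_diff_left inner_diff_right
        inner_commute)
  finally have "(norm (xb - a0))\<^sup>2 + (norm (xb - c0))\<^sup>2 \<le> 0" by linarith
  then have "a0 = xb" "c0 = xb"
    unfolding sum_power2_le_zero_iff norm_eq_zero right_minus_eq by blast+
  with a0 c0 show ?thesis
    by (simp add: zero_pair_def scaleR_2)
qed

text \<open>Boundedness gives weak cluster points along every finer filter, each determined by a
  zero. Convergence of the distances to two such points makes them equal, and the subfilter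
  criterion upgrades this to convergence of the sequences.\<close>

theorem weak_convergence:
  assumes zero: "zero_pair p a"
  obtains zb xb where "converges_weakly z zb" "converges_weakly x xb" "converges_weakly y xb"
    "zero_pair xb (zb - xb)"
proof -
  obtain M where M: "\<And>k. norm (z k) \<le> M" "\<And>k. norm (x k) \<le> M" "\<And>k. norm (y k) \<le> M"
    using iterates_bounded[OF zero] by blast
  have cluster: "\<exists>F' zb xb. F' \<noteq> bot \<and> F' \<le> F \<and>
      (\<forall>u. ((\<lambda>k. inner (z k) u) \<longlongrightarrow> inner zb u) F') \<and>
      (\<forall>u. ((\<lambda>k. inner (x k) u) \<longlongrightarrow> inner xb u) F') \<and> zero_pair xb (zb - xb)"
    if F: "F \<noteq> bot" "F \<le> sequentially" for F
  proof -
    obtain F1 zb where F1: "F1 \<noteq> bot" "F1 \<le> F"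
      and zb: "\<And>u. ((\<lambda>k. inner (z k) u) \<longlongrightarrow> inner zb u) F1"
      using bounded_weakly_convergent_subfilter[where X = z, OF F(1) M(1)] by auto
    obtain F2 xb where F2: "F2 \<noteq> bot" "F2 \<le> F1"
      and xb: "\<And>u. ((\<lambda>k. inner (x k) u) \<longlongrightarrow> inner xb u) F2"
      using bounded_weakly_convergent_subfilter[where X = x, OF F1(1) M(2)] by auto
    have zb': "((\<lambda>k. inner (z k) u) \<longlongrightarrow> inner zb u) F2" for u
      by (rule tendsto_mono[OF F2(2) zb])
    have "F2 \<le> F" using F1 F2 by simp
    moreover from this have "zero_pair xb (zb - xb)"
      using weak_limit_point[OF zero F2(1) _ zb' xb] F(2) by simp
    ultimately show ?thesis using F2(1) zb' xb by blast
  qed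
  obtain F0 zb xb where F0: "F0 \<noteq> bot" "F0 \<le> sequentially"
    and zb: "\<And>u. ((\<lambda>k. inner (z k) u) \<longlongrightarrow> inner zb u) F0"
    and zero_b: "zero_pair xb (zb - xb)"
    using cluster[of sequentially] by auto
  have unique: "zb' = zb" "xb' = xb"
    if F': "F' \<noteq> bot" "F' \<le> sequentially"
      and zb': "\<And>u. ((\<lambda>k. inner (z k) u) \<longlongrightarrow> inner zb' u) F'"
      and zero_b': "zero_pair xb' (zb' - xb')" for F' zb' xb'
  proof -
    obtain l l' where l: "(\<lambda>k. (norm (z k - zb))\<^sup>2) \<longlonglongrightarrow> l"
      and l': "(\<lambda>k. (norm (z k - zb'))\<^sup>2) \<longlonglongrightarrow> l'"
      using z_distance_convergent[OF zero_b] z_distance_convergent[OF zero_b']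
      by (auto simp: convergent_def)
    \<comment> \<open>Half the difference of the squared distances, corrected by the norms of the
      two limits, isolates \<open>inner (z k) (zb' - zb)\<close>, which therefore converges along
      the full sequence.\<close>
    define e where "e = (l - l' - (norm zb)\<^sup>2 + (norm zb')\<^sup>2) / 2"
    have "(\<lambda>k. ((norm (z k - zb))\<^sup>2 - (norm (z k - zb'))\<^sup>2 - (norm zb)\<^sup>2 + (norm zb')\<^sup>2) / 2)
        \<longlonglongrightarrow> e"
      unfolding e_def by (intro tendsto_intros l l') simp
    moreover have "((norm (z k - zb))\<^sup>2 - (norm (z k - zb'))\<^sup>2 - (norm zb)\<^sup>2 + (norm zb')\<^sup>2) / 2
        = inner (z k) (zb' - zb)" for k
      by (simp add: power2_norm_eq_inner inner_diff_left inner_diff_right inner_commute)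
    ultimately have e: "(\<lambda>k. inner (z k) (zb' - zb)) \<longlonglongrightarrow> e" by simp
    have "inner zb (zb' - zb) = e"
      using tendsto_unique[OF F0(1) zb tendsto_mono[OF F0(2) e]] .
    moreover have "inner zb' (zb' - zb) = e"
      using tendsto_unique[OF F'(1) zb' tendsto_mono[OF F'(2) e]] .
    ultimately have "inner (zb' - zb) (zb' - zb) = 0" by (simp add: inner_diff_left)
    then show "zb' = zb" by simp
    \<comment> \<open>Both points are resolvent points of \<open>A\<close> at the same
      \<open>zb\<close>.\<close>
    then show "xb' = xb"
      using zero_b zero_b' A monotone_resolvent_unique[of A zb xb' xb]
      by (simp add: zero_pair_def maximally_monotone_def)
  qed
  have sub: "\<exists>F'. F' \<noteq> bot \<and> F' \<le> F \<and> (\<forall>u. ((\<lambda>k. inner (z k) u) \<longlongrightarrow> inner zb u) F') \<and>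
      (\<forall>u. ((\<lambda>k. inner (x k) u) \<longlongrightarrow> inner xb u) F')"
    if F: "F \<noteq> bot" "F \<le> sequentially" for F
  proof -
    obtain F' zb' xb' where F': "F' \<noteq> bot" "F' \<le> F"
      and zb': "\<And>u. ((\<lambda>k. inner (z k) u) \<longlongrightarrow> inner zb' u) F'"
      and xb': "\<And>u. ((\<lambda>k. inner (x k) u) \<longlongrightarrow> inner xb' u) F'"
      and zero_b': "zero_pair xb' (zb' - xb')"
      using cluster[OF F] by blast
    have "F' \<le> sequentially" using F' F by simp
    from unique[OF F'(1) this zb' zero_b'] zb' xb' F' show ?thesis by blast
  qed
  have z_weak: "converges_weakly z zb"
    unfolding converges_weakly_def
    by (intro allI tendsto_by_subfilters) (use sub in blast)
  have x_weak: "converges_weakly x xb"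
    unfolding converges_weakly_def
    by (intro allI tendsto_by_subfilters) (use sub in blast)
  have "converges_weakly y xb"
    unfolding converges_weakly_def
  proof
    fix u
    have "(\<lambda>k. inner (x k) u) \<longlonglongrightarrow> inner xb u"
      using x_weak by (simp add: converges_weakly_def)
    with tendsto_inner[OF difference_tendsto_0[OF zero] tendsto_const]
    have "(\<lambda>k. inner (y k - x k) u + inner (x k) u) \<longlonglongrightarrow> inner 0 u + inner xb u"
      by (rule tendsto_add)
    then show "(\<lambda>k. inner (y k) u) \<longlonglongrightarrow> inner xb u"
      by (simp add: inner_diff_left)
  qed
  with z_weak x_weak zero_b show thesis by (intro that)
qed

end

subsection \<open>Arbitrary step sizes\<close>

lemma zero_of_sum_iff:
  "p \<in> op_inverse (\<lambda>x. A x + {B x} + C x) 0 \<longleftrightarrow> (\<exists>a\<in>A p. - a - B p \<in> C p)"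
  for A C :: "'a::real_vector \<Rightarrow> 'a set"
proof -
  have "0 = a + B p + c \<longleftrightarrow> c = - a - B p" for a c
  proof -
    have "a + B p + c = c - (- a - B p)" by (simp add: algebra_simps)
    then show ?thesis by (simp only: eq_commute[of 0] right_minus_eq)
  qed
  then show ?thesis
    by (auto simp: op_inverse_def set_plus_def)
qed

theorem theorem3:
  fixes A C :: "'a::{real_inner, banach} \<Rightarrow> 'a set"
    and B :: "'a \<Rightarrow> 'a"
    and L lam :: real
    and x z :: "nat \<Rightarrow> 'a"
    and y :: "int \<Rightarrow> 'a"
  assumes "maximally_monotone A"
    and "maximally_monotone C"
    and "monotone_operator (\<lambda>x. {B x})"
    and "L > 0"
    and "L-lipschitz_on UNIV B"
    and "op_inverse (\<lambda>x. A x + {B x} + C x) 0 \<noteq> {}"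
    and "lam \<in> {0<..<1 / (8 * L)}"
    and "\<And>k::nat. x k = resolvent (op_scale lam A) (z k)"
    and "\<And>k::nat. y (int k) = resolvent (op_scale lam C)
           (2 *\<^sub>R x k - z k - (2 * lam) *\<^sub>R B (y (int k - 1)) + lam *\<^sub>R B (y (int k - 2)))"
    and "\<And>k::nat. z (Suc k) = z k + y (int k) - x k"
  shows "\<exists>zbar xbar.
           converges_weakly z zbar \<and>
           converges_weakly x xbar \<and>
           converges_weakly (\<lambda>k. y (int k)) xbar \<and>
           xbar = resolvent (op_scale lam A) zbar \<and>
           xbar \<in> op_inverse (\<lambda>x. A x + {B x} + C x) 0"
proof -
  have lam: "lam > 0" "lam * L < 1 / 8"
    using assms(4,7) by (auto simp: field_simps)
  have A: "maximally_monotone (op_scale lam A)" and C: "maximally_monotone (op_scale lam C)"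
    using assms(1,2) lam(1) by (auto intro: maximally_monotone_scale)
  \<comment> \<open>Restricting \<open>y\<close> to nonnegative indices drops \<open>y (- 1)\<close>
    and \<open>y (- 2)\<close>; from index 2 on the recursion refers to neither.\<close>
  interpret backward_forward_reflected_backward
    "op_scale lam A" "op_scale lam C" "\<lambda>u. lam *\<^sub>R B u" "lam * L" x "\<lambda>k. y (int k)" z
  proof
    show "0 \<le> inner (u - v) (lam *\<^sub>R B u - lam *\<^sub>R B v)" for u v
      using monotone_operatorD[OF assms(3), of "B u" u "B v" v] lam(1)
      by (simp flip: scaleR_diff_right)
    show "norm (lam *\<^sub>R B u - lam *\<^sub>R B v) \<le> lam * L * norm (u - v)" for u v
      using lipschitz_onD[OF assms(5), of u v] lam(1)
      by (simp add: dist_norm flip: scaleR_diff_right)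
    show "z k - x k \<in> op_scale lam A (x k)" for k
      using assms(8) resolvent_eq_iff[OF A] by blast
    have "y (int k) = resolvent (op_scale lam C) u \<longleftrightarrow> u - y (int k) \<in> op_scale lam C (y (int k))"
      for k u by (rule resolvent_eq_iff[OF C])
    with assms(9) have "2 *\<^sub>R x k - z k - (2 * lam) *\<^sub>R B (y (int k - 1))
        + lam *\<^sub>R B (y (int k - 2)) - y (int k) \<in> op_scale lam C (y (int k))" for k
      by blast
    from this[of "k + 2" for k] show "2 *\<^sub>R x (k + 2) - z (k + 2) - 2 *\<^sub>R (lam *\<^sub>R B (y (int (k + 1))))
        + lam *\<^sub>R B (y (int k)) - y (int (k + 2)) \<in> op_scale lam C (y (int (k + 2)))" for k
      by (simp add: algebra_simps)
    show "z (Suc k) = z k + y (int k) - x k" for k by (rule assms(10))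
  qed (use A C lam assms(4) in auto)
  \<comment> \<open>Scaling by \<open>lam > 0\<close> keeps the zeros and multiplies the witness in
    \<open>A p\<close> by \<open>lam\<close>.\<close>
  have zero_iff: "(\<exists>a. zero_pair p a) \<longleftrightarrow> p \<in> op_inverse (\<lambda>x. A x + {B x} + C x) 0" for p
  proof -
    have "lam *\<^sub>R u = - (lam *\<^sub>R a) - lam *\<^sub>R B p \<longleftrightarrow> u = - a - B p" for a u
      using lam(1) by (simp flip: scaleR_minus_right scaleR_diff_right)
    then show ?thesis
      unfolding zero_of_sum_iff zero_pair_def op_scale_def by (auto simp: image_iff) metis+
  qed
  obtain p a where "zero_pair p a" using assms(6) zero_iff by blast
  then obtain zb xb where conv: "converges_weakly z zb" "converges_weakly x xb"
      "converges_weakly (\<lambda>k. y (int k)) xb" and zero: "zero_pair xb (zb - xb)"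
    by (rule weak_convergence)
  have "xb = resolvent (op_scale lam A) zb"
    using zero by (simp add: resolvent_eq_iff[OF A] zero_pair_def)
  moreover have "xb \<in> op_inverse (\<lambda>x. A x + {B x} + C x) 0"
    using zero zero_iff by blast
  ultimately show ?thesis using conv by blast
qed

end
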